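(* Let $(B,\varphi)$ be a non-commutative probability space over $\mathbb C$ and $(b_n)_{n\in\mathbb N}$ a countable family of elements of $B$. Let $\Phi\in\mathcal G(\mathbb C)$ be the associated moment character, and let $\kappa\in\mathcal L(\mathbb C)$ be the infinitesimal character defined by the fixed point equation $\Phi=\varepsilon_{\mathbb C}+\kappa\prec\Phi$. Then the following functional multivariate free moment-cumulant relation holds in $\mathbb C\langle\langle x_1,x_2,x_3,\dots\rangle\rangle$: $$\widehat\Phi(x)=1+\widehat\kappa\big(x\,\widehat\Phi(x)\big).$$
   Context: A non-commutative probability space $(B,\varphi)$ over $\mathbb C$ is an associative unital $\mathbb C$-algebra $B$ with a linear form $\varphi:B\to\mathbb C$, $\varphi(1_B)=1$. $\mathbb N=\{1,2,\dots\}$, $\mathbb N^*$ is the set of non-empty finite words over $\mathbb N$, $\mathbf 1$ the empty word. $V$ is the $\mathbb C$-vector space with basis $\mathbb N^*$, $T(V)=\bigoplus_{n\ge0}V^{\otimes n}$ is its tensor algebra with unit $\mathbf 1$ (identified with the empty word) and product written with bars, and $T_+(V)=\bigoplus_{n\ge1}V^{\otimes n}$. For $w=a_1\cdots a_n\in\mathbb N^*$ and $S\subseteq[n]$ let $w_S$ be the subword on positions in $S$ ($w_\varnothing=\mathbf 1$), and $J_1^S,\dots,J_m^S$ the maximal intervals of consecutive integers of $[n]\setminus S$, in increasing order. The coproduct is the algebra morphism $\Delta:T(V)\to T(V)\otimes T(V)$ with $\Delta(w)=\sum_{S\subseteq[n]}w_S\otimes w_{J_1^S}|\cdots|w_{J_m^S}$.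 The left half-coproduct on $T_+(V)$ is $\Delta_\prec(w)=w\otimes\mathbf 1+\sum_{1\in S\subsetneq[n]}w_S\otimes w_{J_1^S}|\cdots|w_{J_m^S}$, $\Delta_\prec(w_1|\cdots|w_n)=\Delta_\prec(w_1)\Delta(w_2|\cdots|w_n)$. $\mathcal G(\mathbb C)$ is the set of unital algebra morphisms $T(V)\to\mathbb C$; $\mathcal L(\mathbb C)$ is the set of linear maps $T(V)\to\mathbb C$ vanishing on $\mathbf 1$ and on $\bigoplus_{n\ge2}V^{\otimes n}$; $\varepsilon_{\mathbb C}$ is the counit (equal to $1$ on $\mathbf 1$ and $0$ on $T_+(V)$). For $\kappa$ vanishing on $\mathbf 1$ and $\Phi\in\mathcal G(\mathbb C)$, $\kappa\prec\Phi=m_{\mathbb C}(\kappa\otimes\Phi)\Delta_\prec$ on $T_+(V)$, and $0$ on $\mathbf 1$, where $m_{\mathbb C}$ is the product of $\mathbb C$. The moment character is defined by $\Phi(i_1\cdots i_k)=\varphi(b_{i_1}\cdots b_{i_k})$ for $i_1\cdots i_k\in\mathbb N^*$ (product in $B$) and $\Phi(w_1|\cdots|w_p)=\Phi(w_1)\cdots\Phi(w_p)$. It is known that the fixed point equation determines a unique $\kappa\in\mathcal L(\mathbb C)$, whose values on words are the multivariate free cumulants of $(b_n)$. For a linear form $\mu:T(V)\to\mathbb C$, $\widehat\mu(x)=\mu(\mathbf 1)+\sum_{w\in\mathbb N^*}\mu(w)x_w$, where $x_w=x_{i_1}\cdots x_{i_m}$ for $w=i_1\cdots i_m$ (non-commuting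 variables). $\widehat\kappa(x\widehat\Phi(x))$ is obtained from $\widehat\kappa$ by substituting $x_i\widehat\Phi(x)$ for each $x_i$. *)

theory Defs
  imports Complex_Main "HOL-Library.Poly_Mapping" "HOL-Library.Product_Plus"
begin

section \<open>Non-commutative probability spaces\<close>

text \<open>The class \<open>ring_1\<close> demands \<open>0 \<noteq> 1\<close>, which is no restriction: it is forced by \<open>\<phi> 1 = 1\<close>.\<close>

locale nc_prob_space = Vector_Spaces.linear scale "(*)" \<phi>
  for scale :: "complex \<Rightarrow> 'b::ring_1 \<Rightarrow> 'b" and \<phi> :: "'b \<Rightarrow> complex" +
  assumes scale_mult_left: "scale c x * y = scale c (x * y)"
    and scale_mult_right: "x * scale c y = scale c (x * y)"
    and \<phi>_one: "\<phi> 1 = 1"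


section \<open>The tensor algebra on non-empty words\<close>

text \<open>The index set \<open>{1, 2, \<dots>}\<close>.  All definitions below are made for an arbitrary alphabet \<open>'a\<close>.\<close>

typedef pnat = "{n::nat. 1 \<le> n}"
  by blast

typedef 'a nword = "{w::'a list. w \<noteq> []}"
  by blast

text \<open>\<open>Bars [w\<^sub>1, \<dots>, w\<^sub>n]\<close> stands for \<open>w\<^sub>1|\<dots>|w\<^sub>n\<close>.\<close>

datatype 'a bars = Bars (unbars: "'a nword list")

instantiation bars :: (type) monoid_add
begin

definition "0 = Bars []"
definition "u + v = Bars (unbars u @ unbars v)"

instance
  by standard (simp_all add: zero_bars_def plus_bars_def)

end

text \<open>
  If \<open>V\<close> has a basis \<open>X\<close>, then \<open>T(V)\<close> is the monoid algebra of the free monoid over \<open>X\<close>: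
  the words of length \<open>n\<close> over \<open>X\<close> form a basis of the \<open>n\<close>-th tensor power of \<open>V\<close>, and the
  product of \<open>T(V)\<close> concatenates them. Likewise the tensor product of two monoid algebras is
  the monoid algebra of the product monoid, the pair \<open>(u, v)\<close> standing for \<open>u \<otimes> v\<close>.
  The ring structures are those of \<^theory>\<open>HOL-Library.Poly_Mapping\<close>, where the monoid is
  written additively; the unit \<open>1\<close> is \<open>Poly_Mapping.single 0 1\<close>.
\<close>

type_synonym 'a tensor = "'a bars \<Rightarrow>\<^sub>0 complex"
type_synonym 'a tensor2 = "('a bars \<times> 'a bars) \<Rightarrow>\<^sub>0 complex"

definition pm_scale :: "complex \<Rightarrow> ('k \<Rightarrow>\<^sub>0 complex) \<Rightarrow> ('k \<Rightarrow>\<^sub>0 complex)" where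
  "pm_scale c p = Poly_Mapping.map ((*) c) p"

text \<open>The linear extension of a function on the basis to a vector space with scalar action \<open>s\<close>.\<close>

definition lin_ext :: "(complex \<Rightarrow> 'v \<Rightarrow> 'v) \<Rightarrow> ('k \<Rightarrow> 'v) \<Rightarrow> ('k \<Rightarrow>\<^sub>0 complex) \<Rightarrow> 'v::ab_group_add" where
  "lin_ext s f p = (\<Sum>k\<in>Poly_Mapping.keys p. s (Poly_Mapping.lookup p k) (f k))"

definition linear_form :: "('a tensor \<Rightarrow> complex) \<Rightarrow> bool" where
  "linear_form \<mu> \<longleftrightarrow> Vector_Spaces.linear pm_scale (*) \<mu>"

definition basis :: "'k \<Rightarrow> ('k \<Rightarrow>\<^sub>0 complex)" where
  "basis k = Poly_Mapping.single k 1"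

text \<open>A possibly empty word as a basis element; the empty word is identified with the unit.\<close>

definition bars_of :: "'a list \<Rightarrow> 'a bars" where
  "bars_of w = (if w = [] then 0 else Bars [Abs_nword w])"


lemma lookup_pm_scale [simp]: "Poly_Mapping.lookup (pm_scale c p) k = c * Poly_Mapping.lookup p k"
  by (simp add: pm_scale_def Poly_Mapping.map.rep_eq when_def)

lemma vector_space_pm_scale: "vector_space pm_scale"
  by standard (auto intro!: poly_mapping_eqI simp: lookup_add algebra_simps)

lemma pm_scale_mult:
  fixes p q :: "'k::monoid_add \<Rightarrow>\<^sub>0 complex"
  shows "pm_scale c p * q = pm_scale c (p * q)" and "p * pm_scale c q = pm_scale c (p * q)"
proof -
  show "pm_scale c p * q = pm_scale c (p * q)"
    by (simp add: pm_scale_def mult_map_scale_conv_mult mult.assoc)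
  have comm: "p * Poly_Mapping.single 0 c = Poly_Mapping.single 0 c * p"
  proof (rule poly_mapping_eqI)
    fix k
    have inner: "(\<Sum>q. Poly_Mapping.lookup (Poly_Mapping.single 0 c) q when k = l + q) = (c when l = k)" for l :: 'k
    proof -
      have "(\<lambda>q. Poly_Mapping.lookup (Poly_Mapping.single 0 c) q when k = l + q)
          = (\<lambda>q. (c when l = k) when q = 0)"
        by (auto simp: lookup_single when_def)
      then show ?thesis by (simp only: Sum_any_when_equal)
    qed
    have "Poly_Mapping.lookup (p * Poly_Mapping.single 0 c) k = Poly_Mapping.lookup p k * c"
      by (simp add: lookup_mult inner mult_when)
    also have "\<dots> = Poly_Mapping.lookup (Poly_Mapping.single 0 c * p) k"
      unfolding mult_map_scale_conv_mult[symmetric] pm_scale_def[symmetric] lookup_pm_scale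
      by (rule mult.commute)
    finally show "Poly_Mapping.lookup (p * Poly_Mapping.single 0 c) k
        = Poly_Mapping.lookup (Poly_Mapping.single 0 c * p) k" .
  qed
  show "p * pm_scale c q = pm_scale c (p * q)"
    by (simp add: pm_scale_def mult_map_scale_conv_mult comm flip: mult.assoc)
qed

context
  fixes s :: "complex \<Rightarrow> 'v \<Rightarrow> 'v::ab_group_add"
  assumes s: "vector_space s"
begin

interpretation vector_space s by (rule s)

lemma lin_ext_superset:
  assumes "finite K" "Poly_Mapping.keys p \<subseteq> K"
  shows "lin_ext s f p = (\<Sum>k\<in>K. s (Poly_Mapping.lookup p k) (f k))"
  unfolding lin_ext_def
  by (rule sum.mono_neutral_left) (use assms in \<open>auto simp: in_keys_iff\<close>)

lemma linear_lin_ext: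
  fixes f :: "'k \<Rightarrow> 'v"
  shows "Vector_Spaces.linear pm_scale s (lin_ext s f)"
proof -
  interpret P: vector_space "pm_scale :: complex \<Rightarrow> ('k \<Rightarrow>\<^sub>0 complex) \<Rightarrow> _"
    by (rule vector_space_pm_scale)
  show ?thesis
  proof unfold_locales
    fix p q :: "'k \<Rightarrow>\<^sub>0 complex" and c
    let ?K = "Poly_Mapping.keys p \<union> Poly_Mapping.keys q"
    have "lin_ext s f (p + q) = (\<Sum>k\<in>?K. s (Poly_Mapping.lookup (p + q) k) (f k))"
      by (rule lin_ext_superset) (use keys_add[of p q] in auto)
    also have "\<dots> = (\<Sum>k\<in>?K. s (Poly_Mapping.lookup p k) (f k))
        + (\<Sum>k\<in>?K. s (Poly_Mapping.lookup q k) (f k))"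
      by (simp add: lookup_add scale_left_distrib sum.distrib)
    also have "\<dots> = lin_ext s f p + lin_ext s f q"
      by (subst (1 2) lin_ext_superset[where K = ?K]) auto
    finally show "lin_ext s f (p + q) = lin_ext s f p + lin_ext s f q" .
    have "lin_ext s f (pm_scale c p)
        = (\<Sum>k\<in>Poly_Mapping.keys p. s (Poly_Mapping.lookup (pm_scale c p) k) (f k))"
      by (rule lin_ext_superset) (auto simp: in_keys_iff)
    then show "lin_ext s f (pm_scale c p) = s c (lin_ext s f p)"
      by (simp add: lin_ext_def scale_sum_right)
  qed
qed

lemma lin_ext_basis [simp]: "lin_ext s f (basis k) = f k"
  by (simp add: lin_ext_def basis_def)

end

lemma basis_expansion: "p = (\<Sum>k\<in>Poly_Mapping.keys p. pm_scale (Poly_Mapping.lookup p k) (basis k))"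
proof (rule poly_mapping_eqI)
  fix l
  have "Poly_Mapping.lookup (\<Sum>k\<in>Poly_Mapping.keys p. pm_scale (Poly_Mapping.lookup p k) (basis k)) l
    = (\<Sum>k\<in>Poly_Mapping.keys p. if k = l then Poly_Mapping.lookup p k else 0)"
    unfolding lookup_sum by (rule sum.cong) (simp_all add: basis_def lookup_single)
  also have "\<dots> = Poly_Mapping.lookup p l"
    by (simp add: in_keys_iff)
  finally show "Poly_Mapping.lookup p l = Poly_Mapping.lookup
    (\<Sum>k\<in>Poly_Mapping.keys p. pm_scale (Poly_Mapping.lookup p k) (basis k)) l" ..
qed

lemma basis_mult: "basis k * basis l = basis (k + l)"
  by (simp add: basis_def mult_single)

lemma one_eq_basis: "1 = basis 0"
  by (simp add: basis_def)

lemma lin_ext_mult: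
  fixes s :: "complex \<Rightarrow> 'v \<Rightarrow> 'v::ring_1" and f :: "'k::monoid_add \<Rightarrow> 'v"
  assumes s: "vector_space s"
    and s1: "\<And>c x y. s c x * y = s c (x * y)" and s2: "\<And>c x y. x * s c y = s c (x * y)"
    and f: "\<And>k l. f (k + l) = f k * f l"
  shows "lin_ext s f (p * q) = lin_ext s f p * lin_ext s f q"
proof -
  interpret V: vector_space s by (rule s)
  interpret L: Vector_Spaces.linear pm_scale s "lin_ext s f" by (rule linear_lin_ext[OF s])
  let ?c = Poly_Mapping.lookup and ?K = Poly_Mapping.keys
  have "p * q = (\<Sum>k\<in>?K p. pm_scale (?c p k) (basis k)) * (\<Sum>l\<in>?K q. pm_scale (?c q l) (basis l))"
    by (rule arg_cong2[where f = "(*)", OF basis_expansion basis_expansion])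
  also have "\<dots> = (\<Sum>k\<in>?K p. \<Sum>l\<in>?K q. pm_scale (?c p k) (pm_scale (?c q l) (basis (k + l))))"
    by (simp add: sum_product pm_scale_mult basis_mult)
      (rule sum.cong[OF refl], rule sum.cong[OF refl], rule poly_mapping_eqI, simp)
  finally have "lin_ext s f (p * q) = (\<Sum>k\<in>?K p. \<Sum>l\<in>?K q. s (?c p k) (s (?c q l) (f k * f l)))"
    by (simp only: L.sum L.scale lin_ext_basis[OF s] f)
  also have "\<dots> = lin_ext s f p * lin_ext s f q"
    unfolding lin_ext_def sum_product by (simp add: s1 s2 mult.commute)
  finally show ?thesis .
qed


section \<open>Coproduct and left half-coproduct\<close>

text \<open>
  Positions in a word are numbered from \<open>0\<close>, so that \<open>[n]\<close> is \<open>{..<n}\<close>, the condition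
  \<open>1 \<in> S\<close> becomes \<open>0 \<in> S\<close>, and \<open>nths w S\<close> is the subword on the positions in \<open>S\<close>.
\<close>

text \<open>The maximal interval contained in \<open>A\<close> that starts at \<open>a\<close>, for \<open>a\<close> a left end point.\<close>

definition run_from :: "nat set \<Rightarrow> nat \<Rightarrow> nat set" where
  "run_from A a = {i. a \<le> i \<and> {a..i} \<subseteq> A}"

definition max_intervals :: "nat set \<Rightarrow> nat set list" where
  "max_intervals A = map (run_from A) (sorted_list_of_set {a \<in> A. \<forall>b. a = Suc b \<longrightarrow> b \<notin> A})"

lemma max_intervals_eq:
  assumes "finite A"
  shows "set (max_intervals A) = {{a..b} |a b. a \<le> b \<and> {a..b} \<subseteq> A \<and>
           Suc b \<notin> A \<and> (\<forall>c. a = Suc c \<longrightarrow> c \<notin> A)}" (is "_ = ?R")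
    and "sorted_wrt (\<lambda>I J. \<forall>i\<in>I. \<forall>j\<in>J. i < j) (max_intervals A)"
proof -
  let ?L = "{a \<in> A. \<forall>b. a = Suc b \<longrightarrow> b \<notin> A}"
  have fin: "finite ?L" using assms by simp
  have run: "run_from A a = {a..b}" if "a \<le> b" "{a..b} \<subseteq> A" "Suc b \<notin> A" for a b
  proof (intro set_eqI iffI)
    fix i assume "i \<in> run_from A a"
    then have i: "a \<le> i" "{a..i} \<subseteq> A" by (auto simp: run_from_def)
    have "\<not> Suc b \<le> i" using i(2) that(1,3) subsetD[OF i(2), of "Suc b"] by auto
    then show "i \<in> {a..b}" using i by auto
  next
    fix i assume "i \<in> {a..b}"
    then show "i \<in> run_from A a" using that by (auto simp: run_from_def)
  qed
  have ex: "\<exists>b. a \<le> b \<and> {a..b} \<subseteq> A \<and> Suc b \<notin> A" if a: "a \<in> A" for a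
  proof -
    let ?B = "run_from A a"
    have finB: "finite ?B" by (rule finite_subset[OF _ assms]) (auto simp: run_from_def)
    have "a \<in> ?B" using a by (auto simp: run_from_def)
    then have m: "Max ?B \<in> ?B" using finB Max_in by blast
    then have m': "a \<le> Max ?B" "{a..Max ?B} \<subseteq> A" by (auto simp: run_from_def)
    moreover have "Suc (Max ?B) \<notin> A"
    proof
      assume "Suc (Max ?B) \<in> A"
      then have "Suc (Max ?B) \<in> ?B" using m' by (auto simp: run_from_def atLeastAtMostSuc_conv)
      then show False using Max_ge[OF finB, of "Suc (Max ?B)"] by linarith
    qed
    ultimately show ?thesis by blast
  qed
  show "set (max_intervals A) = ?R"
  proof (intro set_eqI iffI)
    fix J assume "J \<in> set (max_intervals A)"
    then obtain a where a: "a \<in> ?L" "J = run_from A a"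
      using fin by (auto simp: max_intervals_def)
    then obtain b where b: "a \<le> b" "{a..b} \<subseteq> A" "Suc b \<notin> A" using ex[of a] by blast
    then have "J = {a..b}" using a(2) run[OF b] by simp
    then show "J \<in> ?R" using a b by auto
  next
    fix J assume "J \<in> ?R"
    then obtain a b where J: "J = {a..b}" "a \<le> b" "{a..b} \<subseteq> A" "Suc b \<notin> A"
      "\<forall>c. a = Suc c \<longrightarrow> c \<notin> A" by blast
    then have "a \<in> ?L" by auto
    moreover have "J = run_from A a" using J(1) run[OF J(2-4)] by simp
    ultimately show "J \<in> set (max_intervals A)" using fin by (auto simp: max_intervals_def)
  qed
  have less: "i < j" if "a \<in> ?L" "a' \<in> ?L" "a < a'" "i \<in> run_from A a" "j \<in> run_from A a'"
    for a a' i j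
  proof -
    have j: "a' \<le> j" using that by (auto simp: run_from_def)
    obtain c where c: "a' = Suc c" using \<open>a < a'\<close> by (cases a') auto
    have "c \<notin> A" using that c by auto
    moreover have "a \<le> c" "{a..i} \<subseteq> A" using that c by (auto simp: run_from_def)
    ultimately have "\<not> c \<le> i" by auto
    then have "\<not> a' \<le> i" using c by simp
    then show ?thesis using j by simp
  qed
  let ?xs = "sorted_list_of_set ?L"
  have "sorted_wrt (<) ?xs" by (rule strict_sorted_list_of_set)
  moreover have "set ?xs = ?L" by (rule set_sorted_list_of_set[OF fin])
  ultimately have "run_from A (?xs ! k) = max_intervals A ! k \<and> ?xs ! k \<in> ?L"
    "m < k \<Longrightarrow> ?xs ! m < ?xs ! k" if "k < length ?xs" for k m
    using that nth_mem[OF that] by (simp_all only: max_intervals_def nth_map sorted_wrt_iff_nth_less)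
  note nth = this
  have len: "length (max_intervals A) = length ?xs"
    unfolding max_intervals_def by (rule length_map)
  show "sorted_wrt (\<lambda>I J. \<forall>i\<in>I. \<forall>j\<in>J. i < j) (max_intervals A)"
    unfolding sorted_wrt_iff_nth_less len
  proof (intro allI impI ballI)
    fix m k i j
    assume mk: "m < k" "k < length ?xs" and ij: "i \<in> max_intervals A ! m" "j \<in> max_intervals A ! k"
    have m: "m < length ?xs" using mk by (rule order.strict_trans)
    show "i < j"
      by (rule less[of "?xs ! m" "?xs ! k"]) (use nth(1)[OF m] nth(1)[OF mk(2)] nth(2)[OF mk(2,1)] ij in \<open>simp_all only:\<close>)
  qed
qed

definition bars_of_compl :: "'a list \<Rightarrow> nat set \<Rightarrow> 'a bars" where
  "bars_of_compl w S =
     Bars (map (\<lambda>J. Abs_nword (nths w J)) (max_intervals ({..<length w} - S)))"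

definition cut :: "'a list \<Rightarrow> nat set \<Rightarrow> 'a tensor2" where
  "cut w S = basis (bars_of (nths w S), bars_of_compl w S)"

definition coproduct_word :: "'a nword \<Rightarrow> 'a tensor2" where
  "coproduct_word v = (let w = Rep_nword v in \<Sum>S\<in>Pow {..<length w}. cut w S)"

definition coproduct_bars :: "'a bars \<Rightarrow> 'a tensor2" where
  "coproduct_bars u = prod_list (map coproduct_word (unbars u))"

definition coproduct :: "'a tensor \<Rightarrow> 'a tensor2" where
  "coproduct = lin_ext pm_scale coproduct_bars"

definition left_coproduct_word :: "'a nword \<Rightarrow> 'a tensor2" where
  "left_coproduct_word v =
     (let w = Rep_nword v in
        basis (bars_of w, 0) + (\<Sum>S\<in>{S. 0 \<in> S \<and> S \<subset> {..<length w}}. cut w S))"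

lemma coproduct_one: "coproduct 1 = 1"
  by (simp add: coproduct_def one_eq_basis lin_ext_basis[OF vector_space_pm_scale]
      coproduct_bars_def zero_bars_def zero_prod_def)

lemma coproduct_mult: "coproduct (p * q) = coproduct p * coproduct q"
  unfolding coproduct_def
  by (rule lin_ext_mult[OF vector_space_pm_scale pm_scale_mult])
    (simp add: coproduct_bars_def plus_bars_def)

text \<open>
  The left half-coproduct lives on \<open>T\<^sub>+(V)\<close>. Its value \<open>0\<close> on the unit is a convention, chosen so
  that the half-convolution \<open>half_conv \<kappa> \<Phi>\<close> below vanishes on the unit, as it should.
\<close>

definition left_coproduct_bars :: "'a bars \<Rightarrow> 'a tensor2" where
  "left_coproduct_bars u = (case unbars u of [] \<Rightarrow> 0
     | v # vs \<Rightarrow> left_coproduct_word v * coproduct (basis (Bars vs)))"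

definition left_coproduct :: "'a tensor \<Rightarrow> 'a tensor2" where
  "left_coproduct = lin_ext pm_scale left_coproduct_bars"


section \<open>Characters, infinitesimal characters, half-convolution\<close>

definition counit :: "'a tensor \<Rightarrow> complex" where
  "counit p = Poly_Mapping.lookup p 0"

definition characters :: "('a tensor \<Rightarrow> complex) set" where
  "characters = {\<Phi>. linear_form \<Phi> \<and> \<Phi> 1 = 1 \<and> (\<forall>p q. \<Phi> (p * q) = \<Phi> p * \<Phi> q)}"

definition inf_characters :: "('a tensor \<Rightarrow> complex) set" where
  "inf_characters = {\<kappa>. linear_form \<kappa> \<and> \<kappa> 1 = 0 \<and>
     (\<forall>p. (\<forall>u\<in>Poly_Mapping.keys p. 2 \<le> length (unbars u)) \<longrightarrow> \<kappa> p = 0)}"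

text \<open>The composition of \<open>\<mu> \<otimes> \<nu>\<close> with the product of the complex numbers.\<close>

definition tensor_form ::
    "('a tensor \<Rightarrow> complex) \<Rightarrow> ('a tensor \<Rightarrow> complex) \<Rightarrow> 'a tensor2 \<Rightarrow> complex" where
  "tensor_form \<mu> \<nu> = lin_ext (*) (\<lambda>(u, v). \<mu> (basis u) * \<nu> (basis v))"

definition half_conv ::
    "('a tensor \<Rightarrow> complex) \<Rightarrow> ('a tensor \<Rightarrow> complex) \<Rightarrow> 'a tensor \<Rightarrow> complex" where
  "half_conv \<kappa> \<Phi> p = tensor_form \<kappa> \<Phi> (left_coproduct p)"

definition moment_character :: "('b::ring_1 \<Rightarrow> complex) \<Rightarrow> ('a \<Rightarrow> 'b) \<Rightarrow> 'a tensor \<Rightarrow> complex" where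
  "moment_character \<phi> b =
     lin_ext (*) (\<lambda>u. \<Prod>w\<leftarrow>unbars u. \<phi> (\<Prod>i\<leftarrow>Rep_nword w. b i))"


lemma vector_space_complex: "vector_space ((*) :: complex \<Rightarrow> complex \<Rightarrow> complex)"
  by standard (simp_all add: algebra_simps)

lemma moment_character_in_characters: "moment_character \<phi> b \<in> characters"
  unfolding characters_def
proof (intro CollectI conjI allI)
  show "linear_form (moment_character \<phi> b)"
    unfolding linear_form_def moment_character_def by (rule linear_lin_ext[OF vector_space_complex])
  show "moment_character \<phi> b 1 = 1"
    by (simp add: moment_character_def one_eq_basis lin_ext_basis[OF vector_space_complex]
        zero_bars_def)
  show "moment_character \<phi> b (p * q) = moment_character \<phi> b p * moment_character \<phi> b q" for p q
    unfolding moment_character_def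
    by (rule lin_ext_mult[OF vector_space_complex]) (simp_all add: plus_bars_def)
qed

lemma moment_character_word:
  "w \<noteq> [] \<Longrightarrow> moment_character \<phi> b (basis (bars_of w)) = \<phi> (\<Prod>i\<leftarrow>w. b i)"
  by (simp add: moment_character_def lin_ext_basis[OF vector_space_complex] bars_of_def
      Abs_nword_inverse)


section \<open>Formal power series in non-commuting variables\<close>

text \<open>A series is the family of its coefficients, indexed by words.\<close>

typedef 'a ncps = "UNIV :: ('a list \<Rightarrow> complex) set"
  morphisms nc_coeff Abs_ncps
  by blast

lemma nc_coeff_Abs [simp]: "nc_coeff (Abs_ncps f) w = f w"
  by (simp add: Abs_ncps_inverse)

lemma ncps_eqI: "(\<And>w. nc_coeff f w = nc_coeff g w) \<Longrightarrow> f = g"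
  by (metis ext nc_coeff_inject)

instantiation ncps :: (type) ab_group_add
begin

definition "0 = Abs_ncps (\<lambda>w. 0)"
definition "f + g = Abs_ncps (\<lambda>w. nc_coeff f w + nc_coeff g w)"
definition "f - g = Abs_ncps (\<lambda>w. nc_coeff f w - nc_coeff g w)"
definition "- f = Abs_ncps (\<lambda>w. - nc_coeff f w)"

instance
  by standard
    (auto intro!: ncps_eqI simp: zero_ncps_def plus_ncps_def minus_ncps_def uminus_ncps_def)

end

text \<open>The sum in the product runs over all factorisations of the word \<open>w\<close>.\<close>

instantiation ncps :: (type) "{one, times}"
begin

definition "1 = Abs_ncps (\<lambda>w. if w = [] then 1 else 0)"
definition "f * g =
  Abs_ncps (\<lambda>w. \<Sum>k\<le>length w. nc_coeff f (take k w) * nc_coeff g (drop k w))"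

instance ..

end

lemma nc_coeff_zero [simp]: "nc_coeff 0 w = 0"
  by (simp add: zero_ncps_def)

lemma nc_coeff_add [simp]: "nc_coeff (f + g) w = nc_coeff f w + nc_coeff g w"
  by (simp add: plus_ncps_def)

lemma nc_coeff_one: "nc_coeff 1 w = (if w = [] then 1 else 0)"
  by (simp add: one_ncps_def)

lemma nc_coeff_mult:
  "nc_coeff (f * g) w = (\<Sum>k\<le>length w. nc_coeff f (take k w) * nc_coeff g (drop k w))"
  by (simp add: times_ncps_def)

lemma nc_coeff_mult_Nil [simp]: "nc_coeff (f * g) [] = nc_coeff f [] * nc_coeff g []"
  by (simp add: nc_coeff_mult)

lemma nc_coeff_mult_Cons:
  "nc_coeff (f * g) (a # w) =
     nc_coeff f [] * nc_coeff g (a # w) + nc_coeff (Abs_ncps (\<lambda>v. nc_coeff f (a # v)) * g) w"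
  unfolding nc_coeff_mult by (simp add: sum.atMost_Suc_shift del: sum.atMost_Suc)

lemma ncps_distrib_right: "(f + g) * h = f * h + g * (h :: 'a ncps)"
  by (rule ncps_eqI) (simp add: nc_coeff_mult algebra_simps sum.distrib)

lemma ncps_distrib_left: "h * (f + g) = h * f + h * (g :: 'a ncps)"
  by (rule ncps_eqI) (simp add: nc_coeff_mult algebra_simps sum.distrib)

lemma ncps_mult_assoc_coeff: "nc_coeff (f * g * h) w = nc_coeff (f * (g * h)) w"
proof (induction w arbitrary: f g h)
  case Nil
  show ?case by simp
next
  case (Cons a w)
  let ?D = "\<lambda>f. Abs_ncps (\<lambda>v. nc_coeff f (a # v))"
  have D: "?D (f * g) = Abs_ncps (\<lambda>v. nc_coeff f [] * nc_coeff (?D g) v) + ?D f * g"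
    by (rule ncps_eqI) (simp add: nc_coeff_mult_Cons)
  have scale: "nc_coeff (Abs_ncps (\<lambda>v. c * nc_coeff k v) * h) w = c * nc_coeff (k * h) w" for c k
    by (simp add: nc_coeff_mult sum_distrib_left mult.assoc)
  have "nc_coeff (f * g * h) (a # w)
      = nc_coeff f [] * nc_coeff g [] * nc_coeff h (a # w) + nc_coeff (?D (f * g) * h) w"
    by (simp only: nc_coeff_mult_Cons[of "f * g"] nc_coeff_mult_Nil)
  also have "nc_coeff (?D (f * g) * h) w
      = nc_coeff f [] * nc_coeff (?D g * h) w + nc_coeff (?D f * (g * h)) w"
    by (simp only: D ncps_distrib_right nc_coeff_add scale Cons.IH)
  finally show ?case
    by (simp only: nc_coeff_mult_Cons[of f "g * h"] nc_coeff_mult_Cons[of g h])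
      (simp only: algebra_simps)
qed

instance ncps :: (type) ring_1
proof
  fix f g h :: "'a ncps"
  show "f * g * h = f * (g * h)"
    by (rule ncps_eqI) (rule ncps_mult_assoc_coeff)
  show "1 * f = f"
  proof (rule ncps_eqI)
    fix w
    show "nc_coeff (1 * f) w = nc_coeff f w"
      by (cases w) (simp_all add: nc_coeff_mult_Cons nc_coeff_one, simp add: nc_coeff_mult)
  qed
  show "f * 1 = f"
  proof (rule ncps_eqI)
    fix w
    have "nc_coeff (f * 1) w
      = (\<Sum>k\<le>length w. if k = length w then nc_coeff f (take k w) else 0)"
      unfolding nc_coeff_mult by (rule sum.cong) (auto simp: nc_coeff_one)
    then show "nc_coeff (f * 1) w = nc_coeff f w" by simp
  qed
  show "(f + g) * h = f * h + g * h" by (rule ncps_distrib_right)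
  show "f * (g + h) = f * g + f * h" by (rule ncps_distrib_left)
  show "(0 :: 'a ncps) \<noteq> 1" by (metis nc_coeff_one nc_coeff_zero zero_neq_one)
qed

definition nc_var :: "'a \<Rightarrow> 'a ncps" where
  "nc_var i = Abs_ncps (\<lambda>w. if w = [i] then 1 else 0)"

text \<open>
  The series obtained from \<open>f\<close> by substituting \<open>g i\<close> for each variable \<open>x\<^sub>i\<close>: the coefficient at \<open>v\<close>
  is the sum over all words \<open>w = i\<^sub>1\<dots>i\<^sub>m\<close> of the coefficient of \<open>f\<close> at \<open>w\<close> times
  that of \<open>g i\<^sub>1 \<cdots> g i\<^sub>m\<close> at \<open>v\<close>. It is meaningful when only finitely many terms are nonzero
  for each \<open>v\<close>; the lemma \<open>finite_nc_subst_support\<close> shows this for \<open>g i = x\<^sub>i h\<close>.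
\<close>

definition nc_subst :: "'a ncps \<Rightarrow> ('a \<Rightarrow> 'a ncps) \<Rightarrow> 'a ncps" where
  "nc_subst f g = Abs_ncps (\<lambda>v. Sum_any (\<lambda>w. nc_coeff f w * nc_coeff (\<Prod>i\<leftarrow>w. g i) v))"

lemma nc_coeff_var_mult:
  "nc_coeff (nc_var i * h) v = (case v of [] \<Rightarrow> 0 | j # u \<Rightarrow> if j = i then nc_coeff h u else 0)"
proof (cases v)
  case Nil
  then show ?thesis by (simp add: nc_var_def)
next
  case (Cons j u)
  have "Abs_ncps (\<lambda>v. nc_coeff (nc_var i) (j # v)) = (if j = i then 1 else 0)"
    by (rule ncps_eqI) (simp add: nc_var_def nc_coeff_one)
  then show ?thesis
    using Cons by (simp add: nc_coeff_mult_Cons) (simp add: nc_var_def)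
qed

lemma nc_subst_support:
  assumes "nc_coeff (\<Prod>i\<leftarrow>w. nc_var i * h) v \<noteq> 0"
  shows "set w \<subseteq> set v \<and> length w \<le> length v"
  using assms
proof (induction w arbitrary: v)
  case Nil
  show ?case by simp
next
  case (Cons i w)
  then obtain u where v: "v = i # u"
    and ne: "nc_coeff (h * (\<Prod>i\<leftarrow>w. nc_var i * h)) u \<noteq> 0"
    by (auto simp: mult.assoc nc_coeff_var_mult split: list.splits if_splits)
  from ne obtain k where "nc_coeff (\<Prod>i\<leftarrow>w. nc_var i * h) (drop k u) \<noteq> 0"
    unfolding nc_coeff_mult by (metis (no_types, lifting) mult_zero_right sum.not_neutral_contains_not_neutral)
  then have "set w \<subseteq> set (drop k u) \<and> length w \<le> length (drop k u)"
    by (rule Cons.IH)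
  then show ?case
    using set_drop_subset[of k u] by (auto simp: v)
qed

lemma finite_nc_subst_support: "finite {w. nc_coeff (\<Prod>i\<leftarrow>w. nc_var i * h) v \<noteq> 0}"
  by (rule finite_subset[OF _ finite_lists_length_le[of "set v" "length v"]])
    (auto dest: nc_subst_support)

definition nc_hat :: "('a tensor \<Rightarrow> complex) \<Rightarrow> 'a ncps" where
  "nc_hat \<mu> = Abs_ncps (\<lambda>w. \<mu> (basis (bars_of w)))"

end

theory Submission
  imports Defs
begin

text \<open>
  Both sides are expanded at a word \<open>a u\<close>. The fixed point equation reads
  \<open>\<Phi>(a u) = \<Sum>\<^bsub>S\<^esub> \<kappa>(a u\<^sub>S) \<Prod>\<^bsub>J\<^esub> \<Phi>(u\<^sub>J)\<close>, where \<open>S\<close> runs over all sets of positions of \<open>u\<close> and \<open>J\<close>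
  over the gaps of \<open>S\<close>. On the other hand, for \<open>h\<close> the series of \<open>\<Phi>\<close>, the coefficient of
  \<open>h x\<^bsub>i\<^esub> h x\<^bsub>j\<^esub> h \<dots>\<close> at \<open>u\<close> sums \<open>\<Prod>\<^bsub>J\<^esub> \<Phi>(u\<^sub>J)\<close> over the \<open>S\<close> with \<open>u\<^sub>S = i j \<dots>\<close>. The latter
  follows by induction on the word \<open>i j \<dots>\<close>, splitting off the least element of \<open>S\<close>.
\<close>

section \<open>Gaps and subwords relative to a least chosen position\<close>

lemma max_intervals_empty [simp]: "max_intervals {} = []"
  by (simp add: max_intervals_def)

text \<open>Position \<open>k\<close> lies outside the union and separates the initial block from
  the shifted copy of \<open>A\<close>, so no interval crosses it. For \<open>k = 0\<close> the
  block is empty and gives no interval.\<close>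

lemma max_intervals_split:
  assumes "finite A"
  shows "max_intervals ({..<k} \<union> (+) (Suc k) ` A)
    = (if k = 0 then [] else [{..<k}]) @ map ((`) ((+) (Suc k))) (max_intervals A)"
proof -
  let ?s = "(+) (Suc k)" and ?B = "{..<k} \<union> (+) (Suc k) ` A"
  define E where "E = {a \<in> A. \<forall>b. a = Suc b \<longrightarrow> b \<notin> A}"
  have E: "finite E" "E \<subseteq> A" using assms by (auto simp: E_def)
  have shift: "?s x \<in> ?B \<longleftrightarrow> x \<in> A" for x by auto
  have "k \<notin> ?B" by auto
  have ends: "{a \<in> ?B. \<forall>b. a = Suc b \<longrightarrow> b \<notin> ?B} = (if k = 0 then {} else {0}) \<union> ?s ` E"
    (is "?L = ?R")
  proof (intro set_eqI)
    fix x
    consider "x \<le> k" | y where "x = ?s y"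
      by (metis le_Suc_ex not_less_eq_eq)
    then show "x \<in> ?L \<longleftrightarrow> x \<in> ?R"
    proof cases
      case 1
      then show ?thesis by (cases x) auto
    next
      case 2
      have "x \<in> ?L \<longleftrightarrow> y \<in> E"
      \<comment> \<open>For \<open>y = 0\<close> the predecessor of \<open>x\<close> is
        \<open>k\<close>, which is outside \<open>?B\<close>, just as \<open>0\<close> has no
        predecessor in \<open>A\<close>.\<close>
      proof (cases y)
        case 0
        then show ?thesis using 2 \<open>k \<notin> ?B\<close> shift[of 0] by (auto simp: E_def)
      next
        case (Suc z)
        then show ?thesis using 2 shift[of y] shift[of z] by (auto simp: E_def)
      qed
      then show ?thesis using 2 by auto
    qed
  qed
  have sorted: "sorted_list_of_set ?R
      = (if k = 0 then [] else [0]) @ map ?s (sorted_list_of_set E)"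
  proof (rule strict_sorted_equal)
    show "sorted_wrt (<) ((if k = 0 then [] else [0]) @ map ?s (sorted_list_of_set E))"
      using strict_sorted_list_of_set[of E] by (auto simp: sorted_wrt_map)
  qed (use E in auto)
  have run0: "run_from ?B 0 = {..<k}"
  proof (intro set_eqI iffI)
    fix i assume "i \<in> run_from ?B 0"
    then have "k \<notin> {0..i}" using \<open>k \<notin> ?B\<close> unfolding run_from_def by blast
    then show "i \<in> {..<k}" by simp
  qed (auto simp: run_from_def)
  have run: "run_from ?B (?s a) = ?s ` run_from A a" for a
  proof (intro set_eqI)
    fix i
    consider "i < ?s a" | j where "i = ?s j" "a \<le> j"
      by (metis add_le_cancel_left le_Suc_ex le_add1 not_le add.assoc)
    then show "i \<in> run_from ?B (?s a) \<longleftrightarrow> i \<in> ?s ` run_from A a"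
    proof cases
      case 1
      then show ?thesis by (auto simp: run_from_def)
    next
      case 2
      have "{?s a..?s j} = ?s ` {a..j}" by (simp only: image_add_atLeastAtMost add.commute)
      then have "{?s a..?s j} \<subseteq> ?B \<longleftrightarrow> {a..j} \<subseteq> A"
        using shift by (simp only: image_subset_iff) blast
      then show ?thesis using 2 by (auto simp: run_from_def)
    qed
  qed
  show ?thesis
    unfolding max_intervals_def ends sorted E_def[symmetric] map_append map_map o_def run
    by (simp add: run0 del: plus_nat.add_Suc)
qed

text \<open>Ensures that \<open>Abs_nword\<close> is applied to genuine non-empty words, so that
  each gap word agrees with its image under \<open>bars_of\<close>.\<close>

lemma nths_max_interval_nonempty:
  assumes "J \<in> set (max_intervals ({..<length u} - S))"
  shows "nths u J \<noteq> []"
proof -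
  have "\<exists>a b. J = {a..b} \<and> a \<le> b \<and> {a..b} \<subseteq> {..<length u} - S"
    using assms unfolding max_intervals_eq(1)[OF finite_Diff[OF finite_lessThan]] by blast
  then obtain a where "a \<in> J" "a < length u" by fastforce
  then have "set (nths u J) \<noteq> {}" by (auto simp: set_nths)
  then show ?thesis by auto
qed

lemma nths_insert_shift:
  "k < length u \<Longrightarrow> nths u (insert k ((+) (Suc k) ` S)) = u ! k # nths (drop (Suc k) u) S"
proof (induction u arbitrary: k)
  case (Cons a u)
  show ?case
  proof (cases k)
    case 0
    then show ?thesis by (simp add: nths_Cons image_iff)
  next
    case (Suc m)
    have "{j. Suc j \<in> insert k ((+) (Suc k) ` S)} = insert m ((+) (Suc m) ` S)"
      using Suc by (auto simp: image_iff)
    then show ?thesis using Suc Cons by (auto simp: nths_Cons)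
  qed
qed simp

section \<open>Sums over sets of positions\<close>

lemma sum_Pow_lessThan_Suc:
  "(\<Sum>S\<in>Pow {..<Suc n}. g S)
    = (\<Sum>S\<in>Pow {..<n}. g (Suc ` S)) + (\<Sum>S\<in>Pow {..<n}. g (insert 0 (Suc ` S)))"
proof -
  have "Pow {..<Suc n} = image Suc ` Pow {..<n} \<union> insert 0 ` image Suc ` Pow {..<n}"
    unfolding lessThan_Suc_eq_insert_0 Pow_insert image_Pow_surj[OF refl] ..
  moreover have "image Suc ` Pow {..<n} \<inter> insert 0 ` image Suc ` Pow {..<n} = {}" by auto
  moreover have "inj_on (image Suc) (Pow {..<n})"
    by (rule inj_on_image_Pow) simp
  moreover have "inj_on (insert 0) (image Suc ` Pow {..<n})"
    by (rule inj_onI) auto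
  ultimately show ?thesis
    by (simp add: sum.union_disjoint sum.reindex)
qed

text \<open>A non-empty set is determined by its least element \<open>k\<close> and the rest,
  renumbered from \<open>0\<close>. In the induction, the sets containing \<open>0\<close> give the
  summand \<open>k = 0\<close>; the others are shifts, which is why \<open>g\<close> must
  vary.\<close>

lemma sum_Pow_lessThan_least:
  "(\<Sum>S\<in>Pow {..<n}. g S)
    = g {} + (\<Sum>k<n. \<Sum>S\<in>Pow {..<n - Suc k}. g (insert k ((+) (Suc k) ` S)))"
proof (induction n arbitrary: g)
  case (Suc n)
  have "Suc ` insert k ((+) (Suc k) ` S) = insert (Suc k) ((+) (Suc (Suc k)) ` S)" for k S
    by (simp add: image_image)
  moreover have "(+) (Suc 0) = Suc" by (simp add: fun_eq_iff)
  ultimately show ?case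
    unfolding sum_Pow_lessThan_Suc Suc.IH[of "\<lambda>S. g (Suc ` S)"]
    by (simp add: sum.lessThan_Suc_shift algebra_simps del: sum.lessThan_Suc)
qed simp

section \<open>Products over gaps\<close>

text \<open>Taking \<open>F\<close> on plain lists lets both the values of a character and the
  coefficients of a series be inserted.\<close>

definition gap_prod :: "('a list \<Rightarrow> complex) \<Rightarrow> 'a list \<Rightarrow> nat set \<Rightarrow> complex" where
  "gap_prod F u S = (\<Prod>J\<leftarrow>max_intervals ({..<length u} - S). F (nths u J))"

lemma gap_prod_empty:
  assumes "F [] = 1"
  shows "gap_prod F u {} = F u"
  using max_intervals_split[of "{}" "length u"] assms
  by (auto simp: gap_prod_def)

text \<open>For \<open>k = 0\<close> there is no gap before \<open>k\<close>;
  \<open>F [] = 1\<close> makes the factor \<open>F (take k u)\<close> harmless.\<close>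

lemma gap_prod_insert:
  assumes "F [] = 1" and k: "k < length u"
  shows "gap_prod F u (insert k ((+) (Suc k) ` S)) = F (take k u) * gap_prod F (drop (Suc k) u) S"
proof -
  have "{..<length u} - insert k ((+) (Suc k) ` S)
      = {..<k} \<union> (+) (Suc k) ` ({..<length u - Suc k} - S)" (is "?A = ?B")
  proof (intro set_eqI)
    fix x
    consider "x < k" | "x = k" | y where "x = Suc k + y"
      by (metis linorder_neqE_nat less_iff_Suc_add add_Suc)
    then show "x \<in> ?A \<longleftrightarrow> x \<in> ?B"
      using k by cases auto
  qed
  then show ?thesis
    using assms by (simp add: gap_prod_def max_intervals_split o_def nths_drop del: plus_nat.add_Suc)
qed

section \<open>Coefficients of the substituted series\<close>

text \<open>In a factorisation of \<open>u\<close> along the product, the variables take the chosen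
  letters and the copies of \<open>h\<close> take the stretches around them. Empty stretches
  contribute \<open>1\<close>, so only the gaps remain.\<close>

lemma nc_coeff_interleaved:
  fixes h :: "'a ncps"
  assumes h: "nc_coeff h [] = 1"
  shows "nc_coeff (h * (\<Prod>i\<leftarrow>w. nc_var i * h)) u
    = (\<Sum>S\<in>Pow {..<length u}. if nths u S = w then gap_prod (nc_coeff h) u S else 0)"
proof (induction w arbitrary: u)
  case Nil
  have "(\<Sum>S\<in>Pow {..<length u}. if nths u S = [] then gap_prod (nc_coeff h) u S else 0)
      = nc_coeff h u"
    \<comment> \<open>Every set with a least element has a non-empty subword, so only the empty set
      contributes.\<close>
    by (subst sum_Pow_lessThan_least)
      (simp add: nths_insert_shift gap_prod_empty[of "nc_coeff h", OF h] del: plus_nat.add_Suc)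
  then show ?case by simp
next
  case (Cons i w)
  let ?G = "h * (\<Prod>i\<leftarrow>w. nc_var i * h)" and ?P = "gap_prod (nc_coeff h)"
  have tail: "nc_coeff (nc_var i * ?G) (drop k u)
      = (if u ! k = i then nc_coeff ?G (drop (Suc k) u) else 0)" if "k < length u" for k
    using that by (simp add: nc_coeff_var_mult Cons_nth_drop_Suc[symmetric])
  have "nc_coeff (h * (\<Prod>i\<leftarrow>i # w. nc_var i * h)) u
      = (\<Sum>k\<le>length u. nc_coeff h (take k u) * nc_coeff (nc_var i * ?G) (drop k u))"
    unfolding nc_coeff_mult[of h "\<Prod>i\<leftarrow>i # w. nc_var i * h"] by (simp add: mult.assoc)
  \<comment> \<open>The term \<open>k = length u\<close> vanishes, since
    \<open>nc_var i * ?G\<close> has constant coefficient \<open>0\<close>.\<close>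
  also have "\<dots> = (\<Sum>k<length u. nc_coeff h (take k u) * nc_coeff (nc_var i * ?G) (drop k u))"
    by (simp add: lessThan_Suc_atMost[symmetric] nc_coeff_var_mult)
  also have "\<dots> = (\<Sum>k<length u. \<Sum>S\<in>Pow {..<length u - Suc k}.
      if nths u (insert k ((+) (Suc k) ` S)) = i # w then ?P u (insert k ((+) (Suc k) ` S)) else 0)"
    by (rule sum.cong[OF refl])
      (auto simp: tail Cons.IH nths_insert_shift gap_prod_insert[of "nc_coeff h", OF h]
        sum_distrib_left simp del: plus_nat.add_Suc intro!: sum.cong)
  also have "\<dots> = (\<Sum>S\<in>Pow {..<length u}. if nths u S = i # w then ?P u S else 0)"
    \<comment> \<open>The empty set adds nothing, its subword being empty.\<close>
    by (subst sum_Pow_lessThan_least[of _ "length u"]) simp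
  finally show ?case .
qed

lemma nc_coeff_subst_Nil: "nc_coeff (nc_subst f (\<lambda>i. nc_var i * h)) [] = nc_coeff f []"
proof -
  have "nc_coeff (\<Prod>i\<leftarrow>w. nc_var i * h) [] = (if w = [] then 1 else 0)" for w
    by (cases w) (simp_all add: nc_coeff_one nc_var_def)
  then have "nc_coeff (nc_subst f (\<lambda>i. nc_var i * h)) [] = Sum_any (\<lambda>w. nc_coeff f w when w = [])"
    unfolding nc_subst_def nc_coeff_Abs by (intro Sum_any.cong) simp
  then show ?thesis by simp
qed

text \<open>The first variable must match \<open>a\<close>, and what follows it is an interleaved
  product read at \<open>u\<close>. Each \<open>S\<close> then selects exactly one word,
  \<open>a # nths u S\<close>, so the sum over words collapses.\<close>

lemma nc_coeff_subst_Cons: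
  assumes h: "nc_coeff h [] = 1"
  shows "nc_coeff (nc_subst f (\<lambda>i. nc_var i * h)) (a # u)
    = (\<Sum>S\<in>Pow {..<length u}. nc_coeff f (a # nths u S) * gap_prod (nc_coeff h) u S)"
proof -
  let ?P = "Pow {..<length u}" and ?M = "\<lambda>w. \<Prod>i\<leftarrow>w. nc_var i * h"
  let ?W = "(\<lambda>S. a # nths u S) ` ?P"
  have prod: "nc_coeff (?M w) (a # u)
      = (\<Sum>S\<in>?P. if a # nths u S = w then gap_prod (nc_coeff h) u S else 0)" for w
  proof (cases w)
    case Nil
    then show ?thesis by (simp add: nc_coeff_one)
  next
    case (Cons i w')
    then have "nc_coeff (?M w) (a # u) = (if a = i then nc_coeff (h * ?M w') u else 0)"
      by (simp add: mult.assoc nc_coeff_var_mult)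
    then show ?thesis using Cons by (simp add: nc_coeff_interleaved[OF h])
  qed
  have "nc_coeff (nc_subst f (\<lambda>i. nc_var i * h)) (a # u)
      = (\<Sum>w\<in>?W. nc_coeff f w * nc_coeff (?M w) (a # u))"
    unfolding nc_subst_def nc_coeff_Abs
  proof (rule Sum_any.expand_superset)
    show "{w. nc_coeff f w * nc_coeff (?M w) (a # u) \<noteq> 0} \<subseteq> ?W"
    proof
      fix w assume "w \<in> {w. nc_coeff f w * nc_coeff (?M w) (a # u) \<noteq> 0}"
      then have "(\<Sum>S\<in>?P. if a # nths u S = w then gap_prod (nc_coeff h) u S else 0) \<noteq> 0"
        by (simp add: prod)
      then obtain S where "S \<in> ?P" "(if a # nths u S = w then gap_prod (nc_coeff h) u S else 0) \<noteq> 0"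
        by (rule sum.not_neutral_contains_not_neutral)
      then show "w \<in> ?W" by (auto split: if_splits)
    qed
  qed simp
  also have "\<dots> = (\<Sum>S\<in>?P. \<Sum>w\<in>?W. if a # nths u S = w
      then nc_coeff f w * gap_prod (nc_coeff h) u S else 0)"
    unfolding prod sum_distrib_left by (subst sum.swap) (simp add: if_distrib cong: if_cong)
  also have "\<dots> = (\<Sum>S\<in>?P. nc_coeff f (a # nths u S) * gap_prod (nc_coeff h) u S)"
    by (rule sum.cong) auto
  finally show ?thesis .
qed

section \<open>Half-convolution on words and comparison with the series\<close>

lemma character_Bars:
  assumes "\<Phi> \<in> characters"
  shows "\<Phi> (basis (Bars ws)) = (\<Prod>w\<leftarrow>ws. \<Phi> (basis (Bars [w])))"
proof (induction ws)
  case Nil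
  then show ?case using assms by (simp add: characters_def one_eq_basis zero_bars_def)
next
  case (Cons w ws)
  have "basis (Bars (w # ws)) = basis (Bars [w]) * basis (Bars ws)"
    by (simp add: basis_mult plus_bars_def)
  then show ?case using assms Cons by (simp add: characters_def)
qed

lemma character_bars_of_compl:
  assumes "\<Phi> \<in> characters"
  shows "\<Phi> (basis (bars_of_compl u S)) = gap_prod (\<lambda>w. \<Phi> (basis (bars_of w))) u S"
  unfolding bars_of_compl_def gap_prod_def
  by (subst character_Bars[OF assms], unfold map_map o_def, rule arg_cong[where f = prod_list])
    (auto simp: bars_of_def dest: nths_max_interval_nonempty)

text \<open>The summand \<open>w \<otimes> 1\<close> of the left half-coproduct is the cut at the full set of positions.\<close>

lemma left_coproduct_basis_Cons:
  "left_coproduct (basis (bars_of (a # u))) = (\<Sum>S\<in>Pow {..<length u}. cut (a # u) (insert 0 (Suc ` S)))"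
proof -
  let ?v = "a # u" and ?Q = "{S. 0 \<in> S \<and> S \<subset> {..<length (a # u)}}"
  have full: "cut ?v {..<length ?v} = basis (bars_of ?v, 0)"
    by (simp add: cut_def bars_of_compl_def zero_bars_def nths_upt_eq_take)
  have sets: "insert {..<length ?v} ?Q = (\<lambda>S. insert 0 (Suc ` S)) ` Pow {..<length u}"
  proof -
    have "insert {..<length ?v} ?Q = {S \<in> Pow {..<Suc (length u)}. 0 \<in> S}" by auto
    also have "\<dots> = insert 0 ` image Suc ` Pow {..<length u}"
      unfolding lessThan_Suc_eq_insert_0 Pow_insert image_Pow_surj[OF refl] by auto
    finally show ?thesis unfolding image_image .
  qed
  have inj: "inj_on (\<lambda>S. insert 0 (Suc ` S)) (Pow {..<length u})"
  proof (rule inj_onI)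
    fix S T :: "nat set"
    assume "insert 0 (Suc ` S) = insert 0 (Suc ` T)"
    then have "Suc ` S = Suc ` T" by (metis insert_ident zero_notin_Suc_image)
    then show "S = T" by (simp add: inj_image_eq_iff)
  qed
  have "left_coproduct (basis (bars_of ?v)) = left_coproduct_word (Abs_nword ?v) * coproduct 1"
    by (simp add: left_coproduct_def lin_ext_basis[OF vector_space_pm_scale] bars_of_def
        left_coproduct_bars_def one_eq_basis zero_bars_def)
  also have "\<dots> = cut ?v {..<length ?v} + (\<Sum>S\<in>?Q. cut ?v S)"
    by (simp add: coproduct_one left_coproduct_word_def Abs_nword_inverse Let_def flip: full)
  also have "\<dots> = (\<Sum>S\<in>insert {..<length ?v} ?Q. cut ?v S)"
    by (rule sum.insert[symmetric], rule finite_subset[of _ "Pow {..<length ?v}"]) auto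
  also have "\<dots> = (\<Sum>S\<in>Pow {..<length u}. cut ?v (insert 0 (Suc ` S)))"
    unfolding sets by (simp add: sum.reindex[OF inj])
  finally show ?thesis .
qed

text \<open>All cuts involved choose position \<open>0\<close>, so \<open>a\<close> goes to
  \<open>\<kappa>\<close> and the gaps are those of \<open>u\<close>. The sum has the shape found in
  \<open>nc_coeff_subst_Cons\<close>.\<close>

lemma half_conv_basis_Cons:
  assumes \<Phi>: "\<Phi> \<in> characters"
  shows "half_conv \<kappa> \<Phi> (basis (bars_of (a # u)))
    = (\<Sum>S\<in>Pow {..<length u}. \<kappa> (basis (bars_of (a # nths u S)))
        * gap_prod (\<lambda>w. \<Phi> (basis (bars_of w))) u S)"
proof -
  interpret Vector_Spaces.linear pm_scale "(*)" "tensor_form \<kappa> \<Phi>"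
    unfolding tensor_form_def by (rule linear_lin_ext[OF vector_space_complex])
  have "\<Phi> (basis (bars_of [])) = 1"
    using \<Phi> by (simp add: bars_of_def characters_def one_eq_basis)
  note gap = gap_prod_insert[of "\<lambda>w. \<Phi> (basis (bars_of w))", OF this, of 0 "a # u"]
  have Suc: "(+) (Suc 0) = Suc" by (simp add: fun_eq_iff)
  have "tensor_form \<kappa> \<Phi> (cut (a # u) (insert 0 (Suc ` S)))
      = \<kappa> (basis (bars_of (a # nths u S))) * gap_prod (\<lambda>w. \<Phi> (basis (bars_of w))) u S" for S
    using nths_insert_shift[of 0 "a # u" S] gap[of S] \<open>\<Phi> (basis (bars_of [])) = 1\<close>
    by (simp add: tensor_form_def cut_def lin_ext_basis[OF vector_space_complex]
        character_bars_of_compl[OF \<Phi>] Suc)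
  then show ?thesis
    by (simp add: half_conv_def left_coproduct_basis_Cons sum)
qed

lemma character_fixed_point_series:
  assumes \<Phi>: "\<Phi> \<in> characters" and \<kappa>: "\<kappa> 1 = 0"
    and fixed_point: "\<And>p. \<Phi> p = counit p + half_conv \<kappa> \<Phi> p"
  shows "nc_hat \<Phi> = 1 + nc_subst (nc_hat \<kappa>) (\<lambda>i. nc_var i * nc_hat \<Phi>)"
proof (rule ncps_eqI)
  fix v
  have \<Phi>1: "nc_coeff (nc_hat \<Phi>) [] = 1"
    using \<Phi> by (simp add: nc_hat_def bars_of_def characters_def one_eq_basis)
  show "nc_coeff (nc_hat \<Phi>) v
    = nc_coeff (1 + nc_subst (nc_hat \<kappa>) (\<lambda>i. nc_var i * nc_hat \<Phi>)) v"
  proof (cases v)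
    \<comment> \<open>Both constant coefficients are \<open>1\<close>: \<open>\<Phi>\<close> is
      unital and \<open>\<kappa>\<close> vanishes on the unit.\<close>
    case Nil
    then show ?thesis
      using \<kappa> by (simp add: \<Phi>1 nc_coeff_one nc_coeff_subst_Nil)
        (simp add: nc_hat_def bars_of_def one_eq_basis)
  next
    case (Cons a u)
    have "counit (basis (bars_of v)) = 0"
      using Cons by (simp add: counit_def basis_def bars_of_def zero_bars_def lookup_single)
    then have "nc_coeff (nc_hat \<Phi>) v = half_conv \<kappa> \<Phi> (basis (bars_of v))"
      using fixed_point[of "basis (bars_of v)"] by (simp add: nc_hat_def)
    then show ?thesis
      using Cons half_conv_basis_Cons[OF \<Phi>, of \<kappa> a u]
      \<comment> \<open>The coefficient function occurs unapplied as an argument of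
        \<open>gap_prod\<close>, hence the abstracted form of \<open>nc_coeff_Abs\<close>.\<close>
      by (simp add: nc_coeff_one nc_coeff_subst_Cons[OF \<Phi>1]) (simp add: nc_hat_def nc_coeff_Abs[abs_def])
  qed
qed

theorem proposition6p2:
  fixes scale :: "complex \<Rightarrow> 'b::ring_1 \<Rightarrow> 'b" and \<phi> :: "'b \<Rightarrow> complex"
    and b :: "pnat \<Rightarrow> 'b"
    and \<Phi> \<kappa> :: "pnat tensor \<Rightarrow> complex"
  assumes "nc_prob_space scale \<phi>"
    and "\<Phi> = moment_character \<phi> b"
    and "\<kappa> \<in> inf_characters"
    and "\<forall>p. \<Phi> p = counit p + half_conv \<kappa> \<Phi> p"
  shows "nc_hat \<Phi> = 1 + nc_subst (nc_hat \<kappa>) (\<lambda>i. nc_var i * nc_hat \<Phi>)"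
proof (rule character_fixed_point_series)
  show "\<Phi> \<in> characters"
    unfolding assms(2) by (rule moment_character_in_characters)
  show "\<kappa> 1 = 0"
    using assms(3) by (simp add: inf_characters_def)
  show "\<Phi> p = counit p + half_conv \<kappa> \<Phi> p" for p
    using assms(4) by blast
qed

end
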